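(* Let $X$ be an inertial observer (a timelike straight line) in Minkowski spacetime $\mathcal M$, let $L_X$ be the set of all light cones $\Lambda_x$ with $x\in X$, let $<$ be a natural ordering on $X$, and let $\tilde T$ be a clock on $X$ up to an additive constant. Say that a relation $R$ on $\mathcal M$ satisfies (M) if $R$ is not the universal relation and there exist $x\in X$ and $y\in\mathcal M\setminus X$ with $xRy$. Then: 1. There is no implicitly $(X,L_X)$-definable equivalence relation on $\mathcal M$ satisfying (M). 2. The only implicitly $(X,L_X,<)$-definable equivalence relations on $\mathcal M$ satisfying (M) are $\Lambda_X^+$ and $\Lambda_X^-$. Conversely, these two relations are explicitly $(X,L_X,<)$-definable. 3. For every function $f:[0;+\infty[\,\to\mathbb R$ with $f(0)=0$, the relation $\Gamma_{X,\tilde f}$ is explicitly $(X,L_X,\tilde T)$-definable.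
   Context: Minkowski spacetime is $\mathcal M=(\mathbb R^4,\eta,Or)$, where $\eta$ is the Minkowski metric of signature $(+,-,-,-)$ and $Or$ is a time orientation. An inertial observer is a timelike straight line $X\subset\mathcal M$. The light cone of $x$ is $\Lambda_x=\{y : \eta(y-x,y-x)=0\}$; $\Lambda_x^+$ and $\Lambda_x^-$ are its forward and backward halves (each containing $x$). The relations $\Lambda_X^\pm$ on $\mathcal M$ are defined by $p\,\Lambda_X^\pm\,q\Leftrightarrow\exists x\in X,\ p\in\Lambda_x^\pm$ and $q\in\Lambda_x^\pm$. A strict total order $<$ on $X$ is natural if for every $x\in X$ the set $\{x'\in X: x'<x\}$ is an open half-line of $X$ (with endpoint $x$). A clock on $X$ is a continuous function $T:X\to\mathbb R$ such that $(T(x)-T(x'))^2=\eta(x-x',x-x')$ for all $x,x'\in X$; $\tilde T$ is its class modulo additive constants, and the time orientation is the one for which $T$ is increasing towards the future along $X$. Choose inertial coordinates $(t,\vec u)\in\mathbb R\times\mathbb R^3$ on $\mathcal M$ (in units with $c=1$) such that $X$ is the time axis and $t|_X\in\tilde T$. For $h:[0;+\infty[\,\to\mathbb R$ (not necessarily continuous), let $\Gamma_{X,h}$ be the set of events $(t,\vec u)$ with $t=h(\|\vec u\|)$. For $f$ with $f(0)=0$, the relation $\Gamma_{X,\tilde f}$ is defined by $p\,\Gamma_{X,\tilde f}\,q\Leftrightarrow\exists\tau\in\mathbb R,\ p,q\in\Gamma_{X,f+\tau}$. An $(X,L_X)$-automorphism is a bijection $g:\mathbb R^4\to\mathbb R^4$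 with $g(X)=X$ and $\{g(\Lambda):\Lambda\in L_X\}=L_X$. It is an $(X,L_X,<)$-automorphism if moreover $x<x'\Leftrightarrow g(x)<g(x')$ for all $x,x'\in X$. A relation $R$ on $\mathcal M$ is implicitly $S$-definable if $pRq\Rightarrow g(p)Rg(q)$ for every $S$-automorphism $g$ and all events $p,q$. A relation $R$ is explicitly $S$-definable if $xRy\Leftrightarrow\Phi(x,y)$ for some first-order formula $\Phi(x,y)$ with free variables $x,y$ ranging over the bare set $\mathbb R^4$, which refers only to $S$. For $S=(X,L_X,<)$, the formula may use the predicate "$p\in X$", the relation "$x\in X$ and $p\in\Lambda_x$" between events $x,p$, and the order $<$ on $X$. For $S=(X,L_X,\tilde T)$, the formula may use the predicate "$p\in X$", the relation "$x\in X$ and $p\in\Lambda_x$", and the differences $T(x)-T(x')$ for $x,x'\in X$ (which depend only on $\tilde T$) as real numbers, to which the arithmetic operations and order of $\mathbb R$ and the given fixed real function $f$ may be applied. *)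

theory Defs
  imports "HOL-Analysis.Analysis"
begin

section \<open>Minkowski spacetime\<close>

type_synonym event = "real^4"

definition eta :: "event \<Rightarrow> event \<Rightarrow> real" where
  "eta v w = v$1 * w$1 - v$2 * w$2 - v$3 * w$3 - v$4 * w$4"

text \<open>A time orientation is represented by the set of future timelike vectors: one of the two
  classes of timelike vectors under the equivalence relation \<open>eta u v > 0\<close>.\<close>

definition time_orientation :: "event set \<Rightarrow> bool" where
  "time_orientation Or \<longleftrightarrow> (\<exists>u. eta u u > 0 \<and> Or = {v. eta v v > 0 \<and> eta u v > 0})"

definition inertial_observer :: "event set \<Rightarrow> bool" where
  "inertial_observer X \<longleftrightarrow> (\<exists>a v. eta v v > 0 \<and> X = range (\<lambda>s. a + s *\<^sub>R v))"

definition light_cone :: "event \<Rightarrow> event set" where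
  "light_cone x = {y. eta (y - x) (y - x) = 0}"

text \<open>A nonzero null vector is never orthogonal to a timelike one, so the non-strict inequalities
  cut out the two halves of the cone, which have only the vertex in common.\<close>

definition forward_cone :: "event set \<Rightarrow> event \<Rightarrow> event set" where
  "forward_cone Or x = {y \<in> light_cone x. \<forall>v\<in>Or. eta v (y - x) \<ge> 0}"

definition backward_cone :: "event set \<Rightarrow> event \<Rightarrow> event set" where
  "backward_cone Or x = {y \<in> light_cone x. \<forall>v\<in>Or. eta v (y - x) \<le> 0}"

definition Lambda_plus :: "event set \<Rightarrow> event set \<Rightarrow> event rel" where
  "Lambda_plus Or X = {(p, q). \<exists>x\<in>X. p \<in> forward_cone Or x \<and> q \<in> forward_cone Or x}"

definition Lambda_minus :: "event set \<Rightarrow> event set \<Rightarrow> event rel" where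
  "Lambda_minus Or X = {(p, q). \<exists>x\<in>X. p \<in> backward_cone Or x \<and> q \<in> backward_cone Or x}"

definition satisfies_M :: "event set \<Rightarrow> event rel \<Rightarrow> bool" where
  "satisfies_M X R \<longleftrightarrow> R \<noteq> UNIV \<and> (\<exists>x\<in>X. \<exists>y. y \<notin> X \<and> (x, y) \<in> R)"


section \<open>Natural orderings and clocks\<close>

definition open_half_line :: "event set \<Rightarrow> event \<Rightarrow> event set \<Rightarrow> bool" where
  "open_half_line X x H \<longleftrightarrow> H \<subseteq> X \<and> (\<exists>w. w \<noteq> 0 \<and> H = {x + s *\<^sub>R w | s. s > 0})"

definition natural_order :: "event set \<Rightarrow> event rel \<Rightarrow> bool" where
  "natural_order X lt \<longleftrightarrow> lt \<subseteq> X \<times> X \<and> strict_linear_order_on X lt \<and>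
     (\<forall>x\<in>X. open_half_line X x {x' \<in> X. (x', x) \<in> lt})"

text \<open>A function on \<open>X\<close> is represented by a total function of which only the values on \<open>X\<close> matter.\<close>

definition clock :: "event set \<Rightarrow> (event \<Rightarrow> real) \<Rightarrow> bool" where
  "clock X T \<longleftrightarrow> continuous_on X T \<and>
     (\<forall>x\<in>X. \<forall>x'\<in>X. (T x - T x')\<^sup>2 = eta (x - x') (x - x'))"

definition clock_class :: "event set \<Rightarrow> (event \<Rightarrow> real) \<Rightarrow> (event \<Rightarrow> real) set" where
  "clock_class X T = {T'. \<exists>c. \<forall>x\<in>X. T' x = T x + c}"

definition clock_mod_const :: "event set \<Rightarrow> (event \<Rightarrow> real) set \<Rightarrow> bool" where
  "clock_mod_const X Tt \<longleftrightarrow> (\<exists>T. clock X T \<and> Tt = clock_class X T)"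

definition increasing_to_future :: "event set \<Rightarrow> event set \<Rightarrow> (event \<Rightarrow> real) set \<Rightarrow> bool" where
  "increasing_to_future Or X Tt \<longleftrightarrow>
     (\<forall>T\<in>Tt. \<forall>x\<in>X. \<forall>x'\<in>X. x' - x \<in> Or \<longrightarrow> T x < T x')"

text \<open>The difference \<open>T x - T x'\<close>, the same for all \<open>T\<close> in the class.\<close>

definition clock_diff :: "(event \<Rightarrow> real) set \<Rightarrow> event \<Rightarrow> event \<Rightarrow> real" where
  "clock_diff Tt x x' = (THE d. \<forall>T\<in>Tt. T x - T x' = d)"

lemma clock_diff_class:
  assumes "x \<in> X" "x' \<in> X"
  shows "clock_diff (clock_class X T) x x' = T x - T x'"
proof -
  have mem: "T \<in> clock_class X T"
    unfolding clock_class_def by (auto intro!: exI[of _ 0])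
  show ?thesis
    unfolding clock_diff_def
  proof (rule the_equality)
    show "\<forall>T'\<in>clock_class X T. T' x - T' x' = T x - T x'"
      using assms by (auto simp: clock_class_def)
  qed (use mem in auto)
qed


section \<open>Inertial coordinates and the relations \<open>\<Gamma>\<close>\<close>

definition inertial_coordinates :: "(event \<Rightarrow> real \<times> (real^3)) \<Rightarrow> bool" where
  "inertial_coordinates c \<longleftrightarrow>
     bij c \<and> (\<exists>L b. linear L \<and> (\<forall>p. c p = L p + b)) \<and>
     (\<forall>p q. eta (p - q) (p - q)
        = (fst (c p) - fst (c q))\<^sup>2 - (norm (snd (c p) - snd (c q)))\<^sup>2)"

definition adapted_coordinates ::
    "event set \<Rightarrow> (event \<Rightarrow> real) set \<Rightarrow> (event \<Rightarrow> real \<times> (real^3)) \<Rightarrow> bool" where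
  "adapted_coordinates X Tt c \<longleftrightarrow>
     inertial_coordinates c \<and> X = {p. snd (c p) = 0} \<and> (\<lambda>p. fst (c p)) \<in> Tt"

text \<open>A function on \<open>[0;+\<infinity>[\<close> is represented by a total function on the reals; only its values at
  nonnegative arguments enter below.\<close>

definition Gamma_set :: "(event \<Rightarrow> real \<times> (real^3)) \<Rightarrow> (real \<Rightarrow> real) \<Rightarrow> event set" where
  "Gamma_set c h = {p. fst (c p) = h (norm (snd (c p)))}"

definition Gamma_rel :: "(event \<Rightarrow> real \<times> (real^3)) \<Rightarrow> (real \<Rightarrow> real) \<Rightarrow> event rel" where
  "Gamma_rel c f =
     {(p, q). \<exists>\<tau>. p \<in> Gamma_set c (\<lambda>r. f r + \<tau>) \<and> q \<in> Gamma_set c (\<lambda>r. f r + \<tau>)}"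


section \<open>Implicit definability\<close>

definition L_cones :: "event set \<Rightarrow> event set set" where
  "L_cones X = light_cone ` X"

definition XL_automorphisms :: "event set \<Rightarrow> (event \<Rightarrow> event) set" where
  "XL_automorphisms X =
     {g. bij g \<and> g ` X = X \<and> {g ` \<Lambda> | \<Lambda>. \<Lambda> \<in> L_cones X} = L_cones X}"

definition XL_order_automorphisms :: "event set \<Rightarrow> event rel \<Rightarrow> (event \<Rightarrow> event) set" where
  "XL_order_automorphisms X lt =
     {g \<in> XL_automorphisms X. \<forall>x\<in>X. \<forall>x'\<in>X. (x, x') \<in> lt \<longleftrightarrow> (g x, g x') \<in> lt}"

definition implicitly_definable :: "(event \<Rightarrow> event) set \<Rightarrow> event rel \<Rightarrow> bool" where
  "implicitly_definable Aut R \<longleftrightarrow> (\<forall>g\<in>Aut. \<forall>p q. (p, q) \<in> R \<longrightarrow> (g p, g q) \<in> R)"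


section \<open>Explicit definability\<close>

text \<open>First-order formulas with equality over the domain of all events, with variables named by
  natural numbers. The formula \<open>OnCone x p\<close> says that \<open>x \<in> X\<close> and that \<open>p\<close> lies on the light cone
  of \<open>x\<close>; the atoms specific to a structure are supplied by the type parameter.\<close>

datatype 'a fm =
    EqF nat nat
  | InX nat
  | OnCone nat nat
  | Atom 'a
  | Neg "'a fm"
  | Conj "'a fm" "'a fm"
  | Exists nat "'a fm"

primrec fv :: "('a \<Rightarrow> nat set) \<Rightarrow> 'a fm \<Rightarrow> nat set" where
  "fv V (EqF i j) = {i, j}"
| "fv V (InX i) = {i}"
| "fv V (OnCone i j) = {i, j}"
| "fv V (Atom a) = V a"
| "fv V (Neg \<phi>) = fv V \<phi>"
| "fv V (Conj \<phi> \<psi>) = fv V \<phi> \<union> fv V \<psi>"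
| "fv V (Exists i \<phi>) = fv V \<phi> - {i}"

primrec sat ::
    "event set \<Rightarrow> ((nat \<Rightarrow> event) \<Rightarrow> 'a \<Rightarrow> bool) \<Rightarrow> (nat \<Rightarrow> event) \<Rightarrow> 'a fm \<Rightarrow> bool" where
  "sat X I e (EqF i j) \<longleftrightarrow> e i = e j"
| "sat X I e (InX i) \<longleftrightarrow> e i \<in> X"
| "sat X I e (OnCone i j) \<longleftrightarrow> e i \<in> X \<and> e j \<in> light_cone (e i)"
| "sat X I e (Atom a) \<longleftrightarrow> I e a"
| "sat X I e (Neg \<phi>) \<longleftrightarrow> \<not> sat X I e \<phi>"
| "sat X I e (Conj \<phi> \<psi>) \<longleftrightarrow> sat X I e \<phi> \<and> sat X I e \<psi>"
| "sat X I e (Exists i \<phi>) \<longleftrightarrow> (\<exists>p. sat X I (e(i := p)) \<phi>)"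

definition explicitly_definable ::
    "event set \<Rightarrow> ('a \<Rightarrow> nat set) \<Rightarrow> ((nat \<Rightarrow> event) \<Rightarrow> 'a \<Rightarrow> bool) \<Rightarrow> event rel \<Rightarrow> bool" where
  "explicitly_definable X V I R \<longleftrightarrow>
     (\<exists>\<phi>. fv V \<phi> \<subseteq> {0, 1} \<and> (\<forall>e. (e 0, e 1) \<in> R \<longleftrightarrow> sat X I e \<phi>))"

datatype order_atom = Less nat nat

primrec order_atom_vars :: "order_atom \<Rightarrow> nat set" where
  "order_atom_vars (Less i j) = {i, j}"

primrec order_atom_sat :: "event rel \<Rightarrow> (nat \<Rightarrow> event) \<Rightarrow> order_atom \<Rightarrow> bool" where
  "order_atom_sat lt e (Less i j) \<longleftrightarrow> (e i, e j) \<in> lt"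

definition explicitly_XL_order_definable :: "event set \<Rightarrow> event rel \<Rightarrow> event rel \<Rightarrow> bool" where
  "explicitly_XL_order_definable X lt R \<longleftrightarrow>
     explicitly_definable X order_atom_vars (order_atom_sat lt) R"

text \<open>Real-valued terms: \<open>TDiff x x'\<close> denotes \<open>T x - T x'\<close> and \<open>App\<close> the given function \<open>f\<close>. There
  are no constants for individual reals other than 0 and 1. Terms outside their domain (a clock
  difference at events off \<open>X\<close>, \<open>f\<close> at a negative argument, division by zero) have value 0; in
  particular the values of \<open>f\<close> at negative arguments are not accessible.\<close>

datatype rtm =
    TDiff nat nat
  | RZero
  | ROne
  | RAdd rtm rtm
  | RSub rtm rtm
  | RMul rtm rtm
  | RDiv rtm rtm
  | App rtm

datatype clock_atom = REq rtm rtm | RLess rtm rtm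

primrec rtm_vars :: "rtm \<Rightarrow> nat set" where
  "rtm_vars (TDiff i j) = {i, j}"
| "rtm_vars RZero = {}"
| "rtm_vars ROne = {}"
| "rtm_vars (RAdd s t) = rtm_vars s \<union> rtm_vars t"
| "rtm_vars (RSub s t) = rtm_vars s \<union> rtm_vars t"
| "rtm_vars (RMul s t) = rtm_vars s \<union> rtm_vars t"
| "rtm_vars (RDiv s t) = rtm_vars s \<union> rtm_vars t"
| "rtm_vars (App t) = rtm_vars t"

primrec rtm_val ::
    "event set \<Rightarrow> (event \<Rightarrow> real) set \<Rightarrow> (real \<Rightarrow> real) \<Rightarrow> (nat \<Rightarrow> event) \<Rightarrow> rtm \<Rightarrow> real" where
  "rtm_val X Tt f e (TDiff i j) =
     (if e i \<in> X \<and> e j \<in> X then clock_diff Tt (e i) (e j) else 0)"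
| "rtm_val X Tt f e RZero = 0"
| "rtm_val X Tt f e ROne = 1"
| "rtm_val X Tt f e (RAdd s t) = rtm_val X Tt f e s + rtm_val X Tt f e t"
| "rtm_val X Tt f e (RSub s t) = rtm_val X Tt f e s - rtm_val X Tt f e t"
| "rtm_val X Tt f e (RMul s t) = rtm_val X Tt f e s * rtm_val X Tt f e t"
| "rtm_val X Tt f e (RDiv s t) = rtm_val X Tt f e s / rtm_val X Tt f e t"
| "rtm_val X Tt f e (App t) =
     (if rtm_val X Tt f e t \<ge> 0 then f (rtm_val X Tt f e t) else 0)"

primrec clock_atom_vars :: "clock_atom \<Rightarrow> nat set" where
  "clock_atom_vars (REq s t) = rtm_vars s \<union> rtm_vars t"
| "clock_atom_vars (RLess s t) = rtm_vars s \<union> rtm_vars t"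

primrec clock_atom_sat ::
    "event set \<Rightarrow> (event \<Rightarrow> real) set \<Rightarrow> (real \<Rightarrow> real) \<Rightarrow> (nat \<Rightarrow> event) \<Rightarrow> clock_atom \<Rightarrow> bool" where
  "clock_atom_sat X Tt f e (REq s t) \<longleftrightarrow> rtm_val X Tt f e s = rtm_val X Tt f e t"
| "clock_atom_sat X Tt f e (RLess s t) \<longleftrightarrow> rtm_val X Tt f e s < rtm_val X Tt f e t"

definition explicitly_XL_clock_definable ::
    "event set \<Rightarrow> (event \<Rightarrow> real) set \<Rightarrow> (real \<Rightarrow> real) \<Rightarrow> event rel \<Rightarrow> bool" where
  "explicitly_XL_clock_definable X Tt f R \<longleftrightarrow>
     explicitly_definable X clock_atom_vars (clock_atom_sat X Tt f) R"

end

theory Submission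
  imports Defs
begin

text \<open>Parametrise \<open>X\<close> by proper time. An event \<open>p\<close> lies on the light cones of exactly two points
  of \<open>X\<close>, with parameters \<open>lo p \<le> hi p\<close>, and \<open>lo p = hi p\<close> iff \<open>p \<in> X\<close>. Hence every bijection
  \<open>\<phi>\<close> of the parameter line lifts to an automorphism, and so does every permutation of the
  events sharing the same pair \<open>(lo, hi)\<close>. If an invariant equivalence relation links \<open>x \<in> X\<close> to
  \<open>y \<notin> X\<close>, and the parameter of \<open>x\<close> is neither \<open>lo y\<close> nor \<open>hi y\<close>, some increasing \<open>\<phi>\<close> moves \<open>x\<close>
  while fixing \<open>lo y\<close> and \<open>hi y\<close>; this links two points of \<open>X\<close>, and then all events. So a nontrivial
  relation must be the kernel of \<open>lo\<close> or of \<open>hi\<close>, and \<open>\<phi> s = -s\<close> exchanges these two.\<close>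

section \<open>The Minkowski form\<close>

lemma eta_add_left: "eta (x + y) z = eta x z + eta y z"
  and eta_add_right: "eta z (x + y) = eta z x + eta z y"
  and eta_diff_left: "eta (x - y) z = eta x z - eta y z"
  and eta_diff_right: "eta z (x - y) = eta z x - eta z y"
  and eta_scale_left: "eta (c *\<^sub>R x) z = c * eta x z"
  and eta_scale_right: "eta z (c *\<^sub>R x) = c * eta z x"
  and eta_minus_left: "eta (- x) z = - eta x z"
  and eta_minus_right: "eta z (- x) = - eta z x"
  and eta_zero_left: "eta 0 z = 0"
  and eta_zero_right: "eta z 0 = 0"
  by (simp_all add: eta_def algebra_simps)

lemmas eta_bilinear = eta_add_left eta_add_right eta_diff_left eta_diff_right
  eta_scale_left eta_scale_right eta_minus_left eta_minus_right eta_zero_left eta_zero_right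

lemma eta_commute: "eta x y = eta y x"
  by (simp add: eta_def algebra_simps)

lemma event_eqI:
  fixes x y :: event
  assumes "x $ 1 = y $ 1" "x $ 2 = y $ 2" "x $ 3 = y $ 3" "x $ 4 = y $ 4"
  shows "x = y"
  using assms by (simp add: vec_eq_iff forall_4)

text \<open>Reverse Cauchy-Schwarz argument: orthogonality equates \<open>n$1 * v$1\<close> with a
  spatial inner product, whose square is at most \<open>N * V\<close>. If \<open>n\<close> were not
  spacelike, \<open>N\<close> would be at most the square of \<open>n$1\<close>, while
  \<open>V\<close> is strictly below that of \<open>v$1\<close>; this forces \<open>N = 0\<close>
  and then \<open>n$1 = 0\<close>.\<close>

lemma timelike_orthogonal:
  assumes v: "eta v v > 0" and orth: "eta n v = 0" and "n \<noteq> 0"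
  shows "eta n n < 0"
proof (rule ccontr)
  define N where "N = (n$2)\<^sup>2 + (n$3)\<^sup>2 + (n$4)\<^sup>2"
  define V where "V = (v$2)\<^sup>2 + (v$3)\<^sup>2 + (v$4)\<^sup>2"
  assume "\<not> eta n n < 0"
  then have n1: "N \<le> (n$1)\<^sup>2"
    by (simp add: eta_def N_def power2_eq_square)
  have v1: "V < (v$1)\<^sup>2"
    using v by (simp add: eta_def V_def power2_eq_square)
  have "V \<ge> 0" "N \<ge> 0"
    by (simp_all add: V_def N_def)
  have "n$1 * v$1 = n$2 * v$2 + n$3 * v$3 + n$4 * v$4"
    using orth by (simp add: eta_def)
  \<comment> \<open>Lagrange's identity: the subtracted terms are the squared components of a cross
    product.\<close>
  then have "(n$1 * v$1)\<^sup>2 = N * V - (n$2 * v$3 - n$3 * v$2)\<^sup>2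
      - (n$2 * v$4 - n$4 * v$2)\<^sup>2 - (n$3 * v$4 - n$4 * v$3)\<^sup>2"
    unfolding N_def V_def by (simp add: power2_eq_square algebra_simps)
  then have cs: "(n$1)\<^sup>2 * (v$1)\<^sup>2 \<le> N * V"
    unfolding power_mult_distrib[symmetric] by (smt (verit) zero_le_power2)
  have "N * (v$1)\<^sup>2 \<le> (n$1)\<^sup>2 * (v$1)\<^sup>2"
    using n1 by (simp add: mult_right_mono)
  with cs have "N * ((v$1)\<^sup>2 - V) \<le> 0"
    by (simp add: algebra_simps)
  then have "N = 0"
    using v1 \<open>N \<ge> 0\<close> by (simp add: mult_le_0_iff)
  moreover have "n$1 = 0"
  proof -
    have "(n$1)\<^sup>2 * (v$1)\<^sup>2 \<le> 0"
      using cs \<open>N = 0\<close> by simp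
    moreover have "(v$1)\<^sup>2 > 0"
      using v1 \<open>V \<ge> 0\<close> by linarith
    ultimately show ?thesis
      by (simp add: mult_le_0_iff)
  qed
  moreover have "n$2 = 0" "n$3 = 0" "n$4 = 0"
    using \<open>N = 0\<close> zero_le_power2[of "n$2"] zero_le_power2[of "n$3"] zero_le_power2[of "n$4"]
    unfolding N_def by (smt (verit) power2_eq_iff zero_power2)+
  ultimately have "n = 0"
    by (intro event_eqI) simp_all
  with \<open>n \<noteq> 0\<close> show False ..
qed

text \<open>Were the sign to change, the combination \<open>z\<close> of \<open>u\<close> and
  \<open>v\<close> with nonnegative coefficients would be orthogonal to \<open>n\<close>. It is
  timelike because \<open>eta u v > 0\<close>, so \<open>n\<close> would be spacelike.\<close>

lemma timelike_same_side:
  assumes u: "eta u u > 0" and v: "eta v v > 0" and uv: "eta u v > 0"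
    and n: "eta n n \<ge> 0" and un: "eta u n \<ge> 0"
  shows "eta v n \<ge> 0"
proof (rule ccontr)
  assume "\<not> eta v n \<ge> 0"
  then have neg: "- eta v n > 0"
    by simp
  define z where "z = (- eta v n) *\<^sub>R u + eta u n *\<^sub>R v"
  have "eta z z = (eta v n)\<^sup>2 * eta u u + 2 * ((- eta v n) * eta u n * eta u v)
      + (eta u n)\<^sup>2 * eta v v"
    unfolding z_def by (simp add: eta_bilinear eta_commute[of v u] power2_eq_square algebra_simps)
  moreover have "(eta v n)\<^sup>2 * eta u u > 0"
    using neg u by simp
  moreover have "(- eta v n) * eta u n * eta u v \<ge> 0"
    using neg un uv by (simp only: mult_nonneg_nonneg less_imp_le)
  moreover have "(eta u n)\<^sup>2 * eta v v \<ge> 0"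
    using v by simp
  ultimately have "eta z z > 0"
    by linarith
  moreover have "eta n z = 0"
    unfolding z_def by (simp add: eta_bilinear eta_commute[of n])
  moreover have "n \<noteq> 0"
    using neg by (auto simp: eta_zero_right)
  ultimately have "eta n n < 0"
    by (rule timelike_orthogonal)
  with n show False
    by simp
qed

lemma implicitly_definableD:
  "implicitly_definable A R \<Longrightarrow> g \<in> A \<Longrightarrow> (p, q) \<in> R \<Longrightarrow> (g p, g q) \<in> R"
  by (auto simp: implicitly_definable_def)

section \<open>Emission and reception times\<close>

locale unit_observer =
  fixes a v :: event and X :: "event set"
  assumes unit: "eta v v = 1"
    and X_def: "X = range (\<lambda>s. a + s *\<^sub>R v)"
begin

definition pt :: "real \<Rightarrow> event" where "pt s = a + s *\<^sub>R v"
definition tm :: "event \<Rightarrow> real" where "tm p = eta (p - a) v"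
definition perp :: "event \<Rightarrow> event" where "perp p = p - pt (tm p)"
text \<open>\<open>eta\<close> is negative definite on the orthogonal complement of
  \<open>v\<close>, so this is the Euclidean distance of \<open>p\<close> from the line.\<close>

definition rad :: "event \<Rightarrow> real" where "rad p = sqrt (- eta (perp p) (perp p))"
definition lo :: "event \<Rightarrow> real" where "lo p = tm p - rad p"
definition hi :: "event \<Rightarrow> real" where "hi p = tm p + rad p"

lemma X_eq: "X = range pt"
  unfolding X_def pt_def ..

lemma pt_in_X [simp]: "pt s \<in> X"
  by (simp add: X_eq)

lemma v_nonzero: "v \<noteq> 0"
  using unit by (auto simp: eta_zero_left)

lemma pt_eq_iff [simp]: "pt s = pt s' \<longleftrightarrow> s = s'"
  using v_nonzero by (simp add: pt_def)

lemma eta_perp_v: "eta (perp p) v = 0"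
  by (simp add: perp_def pt_def tm_def eta_bilinear unit)

lemma decompose: "p = pt (tm p) + perp p"
  by (simp add: perp_def)

lemma eta_perp_neg: "perp p \<noteq> 0 \<Longrightarrow> eta (perp p) (perp p) < 0"
  using timelike_orthogonal[OF _ eta_perp_v] unit by simp

lemma eta_perp_perp: "eta (perp p) (perp p) = - (rad p)\<^sup>2"
  using eta_perp_neg[of p] by (cases "perp p = 0") (auto simp: rad_def eta_zero_left)

lemma rad_nonneg [simp]: "rad p \<ge> 0"
  using eta_perp_neg[of p] by (cases "perp p = 0") (auto simp: rad_def eta_zero_left)

lemma rad_eq_0_iff: "rad p = 0 \<longleftrightarrow> perp p = 0"
  using eta_perp_neg[of p] by (cases "perp p = 0") (auto simp: rad_def eta_zero_left)

lemma tm_pt_add: "eta n v = 0 \<Longrightarrow> tm (pt s + n) = s"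
  by (simp add: tm_def pt_def eta_bilinear unit)

lemma perp_pt_add: "eta n v = 0 \<Longrightarrow> perp (pt s + n) = n"
  by (simp add: perp_def tm_pt_add)

lemma lo_pt [simp]: "lo (pt s) = s" and hi_pt [simp]: "hi (pt s) = s"
  using tm_pt_add[of 0 s] perp_pt_add[of 0 s]
  by (simp_all add: lo_def hi_def rad_def eta_zero_left)

lemma lo_le_hi: "lo p \<le> hi p"
  by (simp add: lo_def hi_def)

lemma lo_eq_hi_iff: "lo p = hi p \<longleftrightarrow> p \<in> X"
proof
  assume "lo p = hi p"
  then have "perp p = 0"
    unfolding rad_eq_0_iff[symmetric] by (simp add: lo_def hi_def)
  then show "p \<in> X"
    using decompose[of p] pt_in_X[of "tm p"] by simp
qed (auto simp: X_eq)

lemma lo_less_hi: "p \<notin> X \<Longrightarrow> lo p < hi p"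
  using lo_le_hi[of p] lo_eq_hi_iff[of p] by linarith

lemma in_X_pt_lo: "p \<in> X \<Longrightarrow> p = pt (lo p)"
  by (auto simp: X_eq)

text \<open>Pythagoras: \<open>perp p\<close> is orthogonal to \<open>v\<close>, so the mixed terms
  vanish. The zeros in \<open>s\<close> are the emission and reception times.\<close>

lemma eta_from_pt: "eta (p - pt s) (p - pt s) = (tm p - s)\<^sup>2 - (rad p)\<^sup>2"
proof -
  have eq: "p - pt s = perp p + (tm p - s) *\<^sub>R v"
    by (simp add: perp_def pt_def algebra_simps)
  show ?thesis
    unfolding eq using eta_perp_v[of p] eta_commute[of v "perp p"]
    by (simp add: eta_bilinear eta_perp_perp unit power2_eq_square)
qed

lemma in_light_cone_iff: "p \<in> light_cone (pt s) \<longleftrightarrow> s = lo p \<or> s = hi p"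
proof -
  have "p \<in> light_cone (pt s) \<longleftrightarrow> (tm p - s)\<^sup>2 = (rad p)\<^sup>2"
    by (simp add: light_cone_def eta_from_pt)
  also have "\<dots> \<longleftrightarrow> s = lo p \<or> s = hi p"
    by (auto simp: power2_eq_iff lo_def hi_def)
  finally show ?thesis .
qed

lemma X_neq_UNIV: "\<exists>p. p \<notin> X"
proof -
  \<comment> \<open>Any spacelike vector would do: no multiple of the timelike \<open>v\<close> is
    spacelike.\<close>
  define w :: event where "w = axis 2 1"
  have "eta w w < 0"
    by (simp add: eta_def w_def axis_def)
  moreover have "eta (s *\<^sub>R v) (s *\<^sub>R v) \<ge> 0" for s
    by (simp add: eta_bilinear unit)
  ultimately have "w \<noteq> s *\<^sub>R v" for s
    by (metis not_le)
  then have "a + w \<notin> X"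
    by (auto simp: X_eq pt_def)
  then show ?thesis ..
qed

text \<open>The vertex of a forward cone through \<open>p\<close> is where light reaching
  \<open>p\<close> leaves \<open>X\<close>; that of a backward cone is where light from
  \<open>p\<close> arrives. Each vertex is unique, so each relation is a kernel.\<close>

lemma Lambda_cone_eq:
  assumes Or: "time_orientation Or" and "v \<in> Or"
  shows "Lambda_plus Or X = {(p, q). lo p = lo q}"
    and "Lambda_minus Or X = {(p, q). hi p = hi q}"
proof -
  obtain u where u: "eta u u > 0" and Or_eq: "Or = {w. eta w w > 0 \<and> eta u w > 0}"
    using Or by (auto simp: time_orientation_def)
  have "eta u v > 0"
    using \<open>v \<in> Or\<close> Or_eq by simp
  \<comment> \<open>Reduces the quantifier over \<open>Or\<close> to the single vector
    \<open>v\<close>: the sign passes from \<open>v\<close> to \<open>u\<close>, then from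
    \<open>u\<close> to every \<open>w\<close>.\<close>
  have side: "eta w n \<ge> 0" if "eta n n = 0" "eta v n \<ge> 0" "w \<in> Or" for w n
  proof -
    have "eta u n \<ge> 0"
      using timelike_same_side[of v u n] that u \<open>eta u v > 0\<close> unit by (simp add: eta_commute)
    then show ?thesis
      using timelike_same_side[of u w n] that u Or_eq by simp
  qed
  have time: "eta v (p - pt s) = tm p - s" for p s
    unfolding eta_commute[of v "p - pt s"] by (simp add: eta_bilinear tm_def pt_def unit)
  have fwd: "p \<in> forward_cone Or (pt s) \<longleftrightarrow> s = lo p" for p s
  proof
    assume "p \<in> forward_cone Or (pt s)"
    then have "s = lo p \<or> s = hi p" "tm p - s \<ge> 0"
      using \<open>v \<in> Or\<close> time[of p s] by (auto simp: forward_cone_def in_light_cone_iff)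
    then show "s = lo p"
      using rad_nonneg[of p] unfolding lo_def hi_def by linarith
  next
    assume s: "s = lo p"
    then have "p \<in> light_cone (pt s)"
      by (simp add: in_light_cone_iff)
    moreover have "eta v (p - pt s) \<ge> 0"
      unfolding time by (simp add: s lo_def)
    ultimately show "p \<in> forward_cone Or (pt s)"
      using side[of "p - pt s"] by (simp add: forward_cone_def light_cone_def)
  qed
  have bwd: "p \<in> backward_cone Or (pt s) \<longleftrightarrow> s = hi p" for p s
  proof
    assume "p \<in> backward_cone Or (pt s)"
    then have "s = lo p \<or> s = hi p" "tm p - s \<le> 0"
      using \<open>v \<in> Or\<close> time[of p s] by (auto simp: backward_cone_def in_light_cone_iff)
    then show "s = hi p"
      using rad_nonneg[of p] unfolding lo_def hi_def by linarith
  next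
    assume s: "s = hi p"
    then have cone: "p \<in> light_cone (pt s)"
      by (simp add: in_light_cone_iff)
    \<comment> \<open>\<open>side\<close> concerns the future half, so it is applied to the reversed
      null vector.\<close>
    have "eta v (- (p - pt s)) \<ge> 0"
      unfolding eta_minus_right time by (simp add: s hi_def)
    moreover have "eta (- (p - pt s)) (- (p - pt s)) = 0"
      using cone by (simp only: eta_minus_left eta_minus_right light_cone_def mem_Collect_eq)
    ultimately have "eta w (- (p - pt s)) \<ge> 0" if "w \<in> Or" for w
      using side that by blast
    then have "eta w (p - pt s) \<le> 0" if "w \<in> Or" for w
      using that unfolding eta_minus_right by (simp only: neg_0_le_iff_le)
    with cone show "p \<in> backward_cone Or (pt s)"
      by (simp add: backward_cone_def)
  qed
  show "Lambda_plus Or X = {(p, q). lo p = lo q}" "Lambda_minus Or X = {(p, q). hi p = hi q}"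
    by (auto simp: Lambda_plus_def Lambda_minus_def X_eq fwd bwd)
qed

section \<open>Automorphisms\<close>

text \<open>The event with radar times \<open>\<phi> (lo p)\<close> and \<open>\<phi> (hi p)\<close>
  in the spatial direction of \<open>p\<close>; the absolute value covers the case that
  \<open>\<phi>\<close> reverses their order. On \<open>X\<close> the division by zero is harmless,
  as \<open>perp p = 0\<close>.\<close>

definition lift :: "(real \<Rightarrow> real) \<Rightarrow> event \<Rightarrow> event" where
  "lift \<phi> p = pt ((\<phi> (lo p) + \<phi> (hi p)) / 2)
     + (\<bar>\<phi> (hi p) - \<phi> (lo p)\<bar> / 2 / rad p) *\<^sub>R perp p"

lemma tm_lift: "tm (lift \<phi> p) = (\<phi> (lo p) + \<phi> (hi p)) / 2"
  and perp_lift: "perp (lift \<phi> p) = (\<bar>\<phi> (hi p) - \<phi> (lo p)\<bar> / 2 / rad p) *\<^sub>R perp p"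
  unfolding lift_def by (rule tm_pt_add perp_pt_add, simp add: eta_bilinear eta_perp_v)+

lemma rad_lift: "rad (lift \<phi> p) = \<bar>\<phi> (hi p) - \<phi> (lo p)\<bar> / 2"
proof (cases "rad p = 0")
  case True
  then show ?thesis
    by (simp add: rad_def[of "lift \<phi> p"] perp_lift eta_zero_left lo_def hi_def)
next
  case False
  then have "- eta (perp (lift \<phi> p)) (perp (lift \<phi> p)) = (\<bar>\<phi> (hi p) - \<phi> (lo p)\<bar> / 2)\<^sup>2"
    by (simp add: perp_lift eta_bilinear eta_perp_perp power2_eq_square)
  then show ?thesis
    unfolding rad_def[of "lift \<phi> p"] by (simp only: real_sqrt_abs) simp
qed

lemma lo_lift: "lo (lift \<phi> p) = min (\<phi> (lo p)) (\<phi> (hi p))"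
  and hi_lift: "hi (lift \<phi> p) = max (\<phi> (lo p)) (\<phi> (hi p))"
  by (auto simp: lo_def[of "lift \<phi> p"] hi_def[of "lift \<phi> p"] tm_lift rad_lift min_def max_def
      abs_if field_simps)

lemma lift_pt [simp]: "lift \<phi> (pt s) = pt (\<phi> s)"
  using rad_eq_0_iff[of "pt s"] perp_pt_add[of 0 s] by (simp add: lift_def eta_zero_left)

text \<open>Midpoint and half-distance are symmetric in the two times, so it does not matter whether
  \<open>\<phi>\<close> reverses their order; positive scaling keeps the spatial direction.\<close>

lemma lift_inverse:
  assumes "\<And>s. \<psi> (\<phi> s) = s"
  shows "lift \<psi> (lift \<phi> p) = p"
proof (cases "p \<in> X")
  case True
  then show ?thesis
    using assms by (auto simp: X_eq)
next
  case False
  then have less: "lo p < hi p"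
    by (rule lo_less_hi)
  then have "rad p \<noteq> 0"
    by (simp add: lo_def hi_def)
  \<comment> \<open>Injectivity keeps the new radius away from 0, so that the scale factors
    cancel.\<close>
  have "\<phi> (lo p) \<noteq> \<phi> (hi p)"
    using assms[of "lo p"] assms[of "hi p"] less by force
  have "tm (lift \<psi> (lift \<phi> p)) = (lo p + hi p) / 2"
    by (auto simp: tm_lift[of \<psi>] lo_lift hi_lift assms min_def max_def add.commute)
  also have "\<dots> = tm p"
    by (simp add: lo_def hi_def)
  finally have tm_eq: "tm (lift \<psi> (lift \<phi> p)) = tm p" .
  have "\<bar>\<psi> (hi (lift \<phi> p)) - \<psi> (lo (lift \<phi> p))\<bar> / 2 = rad p"
    using less by (auto simp: lo_lift hi_lift assms min_def max_def) (auto simp: lo_def hi_def)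
  then have perp_eq: "perp (lift \<psi> (lift \<phi> p)) = perp p"
    using \<open>rad p \<noteq> 0\<close> \<open>\<phi> (lo p) \<noteq> \<phi> (hi p)\<close>
    by (simp add: perp_lift[of \<psi>] rad_lift) (simp add: perp_lift)
  show ?thesis
    using decompose[of "lift \<psi> (lift \<phi> p)"] decompose[of p] tm_eq perp_eq by simp
qed

lemma bij_lift:
  assumes "bij \<phi>"
  shows "bij (lift \<phi>)"
  using assms
  by (intro o_bij[of "lift (inv \<phi>)"])
    (auto simp: fun_eq_iff bij_is_inj bij_is_surj surj_f_inv_f lift_inverse)

lemma XL_automorphismI:
  assumes g: "bij g" and \<phi>: "bij \<phi>" and pt: "\<And>s. g (pt s) = pt (\<phi> s)"
    and cone: "\<And>p s. g p \<in> light_cone (pt (\<phi> s)) \<longleftrightarrow> p \<in> light_cone (pt s)"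
  shows "g \<in> XL_automorphisms X"
proof -
  have surj: "range \<phi> = UNIV"
    using \<phi> by (rule bij_is_surj)
  have image: "g ` light_cone (pt s) = light_cone (pt (\<phi> s))" for s
  proof (intro subset_antisym subsetI)
    fix q assume "q \<in> light_cone (pt (\<phi> s))"
    moreover obtain p where "q = g p"
      using g by (meson bij_pointE)
    ultimately show "q \<in> g ` light_cone (pt s)"
      using cone by auto
  qed (use cone in auto)
  have X: "g ` X = X"
  proof -
    have "g ` X = pt ` range \<phi>"
      unfolding X_eq image_image pt ..
    then show ?thesis
      by (simp add: surj X_eq)
  qed
  have "{g ` \<Lambda> | \<Lambda>. \<Lambda> \<in> L_cones X} = (\<lambda>s. g ` light_cone (pt s)) ` UNIV"
    by (auto simp: L_cones_def X_eq)
  also have "\<dots> = (\<lambda>s. light_cone (pt s)) ` range \<phi>"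
    by (simp add: image image_image)
  also have "\<dots> = L_cones X"
    by (auto simp: surj L_cones_def X_eq)
  finally show ?thesis
    using g X by (simp add: XL_automorphisms_def)
qed

lemma lift_automorphism:
  assumes "bij \<phi>"
  shows "lift \<phi> \<in> XL_automorphisms X"
proof (rule XL_automorphismI[OF bij_lift[OF assms] assms lift_pt])
  show "lift \<phi> p \<in> light_cone (pt (\<phi> s)) \<longleftrightarrow> p \<in> light_cone (pt s)" for p s
    using bij_is_inj[OF assms]
    by (auto simp: in_light_cone_iff lo_lift hi_lift min_def max_def inj_eq)
qed

text \<open>Membership in a cone with vertex on \<open>X\<close> depends only on \<open>lo\<close>
  and \<open>hi\<close>, so no such cone notices the swap. Both events lie off \<open>X\<close>,
  which stays fixed pointwise.\<close>

lemma transpose_automorphism: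
  assumes "y \<notin> X" "lo y' = lo y" "hi y' = hi y"
  shows "Transposition.transpose y y' \<in> XL_automorphisms X"
proof (rule XL_automorphismI[of _ id])
  have "y' \<notin> X"
    using assms lo_eq_hi_iff[of y] lo_eq_hi_iff[of y'] by simp
  then have "pt s \<noteq> y" "pt s \<noteq> y'" for s
    using \<open>y \<notin> X\<close> pt_in_X by metis+
  then show fixed: "Transposition.transpose y y' (pt s) = pt (id s)" for s
    by (simp add: transpose_apply_other)
  show "Transposition.transpose y y' p \<in> light_cone (pt (id s)) \<longleftrightarrow> p \<in> light_cone (pt s)" for p s
    using assms by (auto simp: Transposition.transpose_def in_light_cone_iff)
qed (simp_all add: bij_swap)

text \<open>A cone with vertex on \<open>X\<close> meets \<open>X\<close> only in its vertex, so the action of an automorphism on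
  cones is determined by its action on \<open>X\<close>.\<close>

lemma XL_automorphism_cone:
  assumes "g \<in> XL_automorphisms X"
  obtains \<phi> where "\<And>s. g (pt s) = pt (\<phi> s)"
    and "\<And>p s. p \<in> light_cone (pt s) \<Longrightarrow> g p \<in> light_cone (pt (\<phi> s))"
proof
  define \<phi> where "\<phi> s = lo (g (pt s))" for s
  have "g (pt s) \<in> X" for s
    using assms by (auto simp: XL_automorphisms_def)
  then show pt: "g (pt s) = pt (\<phi> s)" for s
    using in_X_pt_lo unfolding \<phi>_def by blast
  show "g p \<in> light_cone (pt (\<phi> s))" if "p \<in> light_cone (pt s)" for p s
  proof -
    have "light_cone (pt s) \<in> L_cones X"
      by (auto simp: L_cones_def)
    then have "g ` light_cone (pt s) \<in> L_cones X"
      using assms by (auto simp: XL_automorphisms_def)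
    then obtain s' where s': "g ` light_cone (pt s) = light_cone (pt s')"
      by (auto simp: L_cones_def X_eq)
    have "pt s \<in> light_cone (pt s)"
      by (simp add: in_light_cone_iff)
    then have "pt (\<phi> s) \<in> light_cone (pt s')"
      using s' pt by (metis imageI)
    then have "\<phi> s = s'"
      by (simp add: in_light_cone_iff)
    then show ?thesis
      using s' that by blast
  qed
qed

section \<open>Natural orders\<close>

text \<open>A priori every point may choose its own direction for its half-line; comparison with
  \<open>pt 0\<close> through asymmetry and totality forces all choices to agree.\<close>

lemma natural_order_cases:
  assumes "natural_order X lt"
  shows "(\<forall>s s'. (pt s, pt s') \<in> lt \<longleftrightarrow> s < s') \<or> (\<forall>s s'. (pt s, pt s') \<in> lt \<longleftrightarrow> s' < s)"
proof -
  have lin: "strict_linear_order_on X lt"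
    and half: "\<And>x. x \<in> X \<Longrightarrow> open_half_line X x {x' \<in> X. (x', x) \<in> lt}"
    using assms by (auto simp: natural_order_def)
  have side: "(\<forall>s'. (pt s', pt s) \<in> lt \<longleftrightarrow> s' < s) \<or> (\<forall>s'. (pt s', pt s) \<in> lt \<longleftrightarrow> s < s')" for s
  proof -
    define H where "H = {x' \<in> X. (x', pt s) \<in> lt}"
    have "open_half_line X (pt s) H"
      unfolding H_def by (rule half) simp
    then obtain w where "H \<subseteq> X" "w \<noteq> 0" and H: "H = {pt s + r *\<^sub>R w | r. r > 0}"
      by (auto simp: open_half_line_def)
    \<comment> \<open>The element with \<open>r = 1\<close> shows that \<open>w\<close> is a
      difference of two points of \<open>X\<close>, hence a multiple of \<open>v\<close>.\<close>
    have "pt s + 1 *\<^sub>R w \<in> H"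
      unfolding H by (rule CollectI, rule exI[of _ 1]) simp
    then obtain s1 where "pt s + 1 *\<^sub>R w = pt s1"
      using \<open>H \<subseteq> X\<close> unfolding X_eq by blast
    then have w: "w = (s1 - s) *\<^sub>R v"
      by (simp add: pt_def algebra_simps)
    define k where "k = s1 - s"
    have "k \<noteq> 0"
      using \<open>w \<noteq> 0\<close> w by (auto simp: k_def)
    have pt_shift: "pt s + r *\<^sub>R w = pt (s + r * k)" for r
      by (simp add: w k_def pt_def algebra_simps)
    have "(pt s', pt s) \<in> lt \<longleftrightarrow> pt s' \<in> H" for s'
      by (simp add: H_def)
    also have "pt s' \<in> H \<longleftrightarrow> (\<exists>r>0. s' = s + r * k)" for s'
      by (auto simp: H pt_shift)
    finally have lt: "(pt s', pt s) \<in> lt \<longleftrightarrow> (\<exists>r>0. s' = s + r * k)" for s' .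
    have ratio: "(\<exists>r>0. s' = s + r * k) \<longleftrightarrow> (s' - s) / k > 0" for s'
      using \<open>k \<noteq> 0\<close> by (auto intro!: exI[of _ "(s' - s) / k"])
    show ?thesis
      using \<open>k \<noteq> 0\<close> unfolding lt ratio
      by (cases "k > 0") (auto simp: zero_less_divide_iff)
  qed
  have asym: "\<not> ((pt s, pt s') \<in> lt \<and> (pt s', pt s) \<in> lt)" for s s'
    using lin unfolding strict_linear_order_on_def by (meson irrefl_def transD)
  have total: "s \<noteq> s' \<Longrightarrow> (pt s, pt s') \<in> lt \<or> (pt s', pt s) \<in> lt" for s s'
    using lin unfolding strict_linear_order_on_def total_on_def by simp
  consider "\<forall>s'. (pt s', pt 0) \<in> lt \<longleftrightarrow> s' < 0" | "\<forall>s'. (pt s', pt 0) \<in> lt \<longleftrightarrow> 0 < s'"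
    using side[of 0] by blast
  then show ?thesis
  proof cases
    case 1
    \<comment> \<open>If \<open>s\<close> had the direction opposite to that of 0, then
      \<open>pt 0\<close> and \<open>pt s\<close> would be related both ways or not at all.\<close>
    have "(pt s', pt s) \<in> lt \<longleftrightarrow> s' < s" for s s'
    proof (cases "s = 0")
      case False
      then show ?thesis
        using 1 side[of s] asym[of 0 s] total[of 0 s] by metis
    qed (use 1 in simp)
    then show ?thesis
      by blast
  next
    case 2
    have "(pt s', pt s) \<in> lt \<longleftrightarrow> s < s'" for s s'
    proof (cases "s = 0")
      case False
      then show ?thesis
        using 2 side[of s] asym[of 0 s] total[of 0 s] by metis
    qed (use 2 in simp)
    then show ?thesis
      by blast
  qed
qed

text \<open>Preserving an order and preserving its converse are the same condition, so both
  directions of \<open>lt\<close> lead to monotonicity of \<open>\<phi>\<close>.\<close>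

lemma order_automorphism_iff:
  assumes "natural_order X lt" and pt: "\<And>s. g (pt s) = pt (\<phi> s)"
  shows "g \<in> XL_order_automorphisms X lt \<longleftrightarrow> g \<in> XL_automorphisms X \<and> strict_mono \<phi>"
proof -
  have "(\<forall>x\<in>X. \<forall>x'\<in>X. (x, x') \<in> lt \<longleftrightarrow> (g x, g x') \<in> lt) \<longleftrightarrow> (\<forall>s s'. s < s' \<longleftrightarrow> \<phi> s < \<phi> s')"
    using natural_order_cases[OF assms(1)] by (auto simp: X_eq pt)
  also have "\<dots> \<longleftrightarrow> strict_mono \<phi>"
    by (auto simp: strict_mono_less intro: strict_monoI)
  finally show ?thesis
    by (simp add: XL_order_automorphisms_def)
qed

text \<open>The two cones through \<open>p\<close> go to the two cones through \<open>g p\<close>,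
  and monotonicity of \<open>\<phi>\<close> prevents their vertices from being exchanged.\<close>

lemma lo_hi_order_automorphism:
  assumes "natural_order X lt" "g \<in> XL_order_automorphisms X lt"
  obtains \<phi> where "\<And>p. lo (g p) = \<phi> (lo p)" "\<And>p. hi (g p) = \<phi> (hi p)"
proof -
  have aut: "g \<in> XL_automorphisms X"
    using assms by (simp add: XL_order_automorphisms_def)
  then obtain \<phi> where pt: "\<And>s. g (pt s) = pt (\<phi> s)"
    and cone: "\<And>p s. p \<in> light_cone (pt s) \<Longrightarrow> g p \<in> light_cone (pt (\<phi> s))"
    using XL_automorphism_cone by blast
  then have mono: "strict_mono \<phi>"
    using order_automorphism_iff assms by blast
  have "lo (g p) = \<phi> (lo p) \<and> hi (g p) = \<phi> (hi p)" for p
  proof (cases "p \<in> X")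
    case True
    then show ?thesis
      by (auto simp: X_eq pt)
  next
    case False
    then have "\<phi> (lo p) < \<phi> (hi p)"
      using mono lo_less_hi by (simp add: strict_mono_less)
    moreover have "\<phi> (lo p) \<in> {lo (g p), hi (g p)}" "\<phi> (hi p) \<in> {lo (g p), hi (g p)}"
      using cone[of p "lo p"] cone[of p "hi p"] by (auto simp: in_light_cone_iff)
    ultimately show ?thesis
      using lo_le_hi[of "g p"] by auto
  qed
  then show thesis
    using that by blast
qed

lemma kernels_satisfy:
  assumes "natural_order X lt"
  shows "equiv UNIV {(p, q). lo p = lo q} \<and>
      implicitly_definable (XL_order_automorphisms X lt) {(p, q). lo p = lo q} \<and>
      satisfies_M X {(p, q). lo p = lo q}"
    and "equiv UNIV {(p, q). hi p = hi q} \<and>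
      implicitly_definable (XL_order_automorphisms X lt) {(p, q). hi p = hi q} \<and>
      satisfies_M X {(p, q). hi p = hi q}"
proof -
  let ?L = "{(p, q). lo p = lo q}" and ?H = "{(p, q). hi p = hi q}"
  have "equiv UNIV ?L" "equiv UNIV ?H"
    by (auto intro!: equivI refl_onI symI transI)
  moreover have "implicitly_definable (XL_order_automorphisms X lt) ?L"
    "implicitly_definable (XL_order_automorphisms X lt) ?H"
    unfolding implicitly_definable_def using lo_hi_order_automorphism[OF assms]
    by (metis (mono_tags, lifting) case_prodD case_prodI mem_Collect_eq)+
  moreover have "satisfies_M X ?L" "satisfies_M X ?H"
  proof -
    obtain y where "y \<notin> X"
      using X_neq_UNIV by blast
    have "(pt 0, pt 1) \<notin> ?L" "(pt 0, pt 1) \<notin> ?H"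
      by simp_all
    moreover have "(pt (lo y), y) \<in> ?L" "(pt (hi y), y) \<in> ?H"
      by simp_all
    ultimately show "satisfies_M X ?L" "satisfies_M X ?H"
      unfolding satisfies_M_def using \<open>y \<notin> X\<close> pt_in_X by blast+
  qed
  ultimately show "equiv UNIV ?L \<and>
      implicitly_definable (XL_order_automorphisms X lt) ?L \<and> satisfies_M X ?L"
    "equiv UNIV ?H \<and>
      implicitly_definable (XL_order_automorphisms X lt) ?H \<and> satisfies_M X ?H"
    by blast+
qed

end

section \<open>Increasing bijections of the line\<close>

definition increasing_bij :: "(real \<Rightarrow> real) \<Rightarrow> bool" where
  "increasing_bij \<phi> \<longleftrightarrow> strict_mono \<phi> \<and> surj \<phi>"

lemma increasing_bij_imp_bij: "increasing_bij \<phi> \<Longrightarrow> bij \<phi>"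
  by (simp add: increasing_bij_def bij_def strict_mono_imp_inj_on)

lemma increasing_bij_affine:
  assumes "k > 0"
  shows "increasing_bij (\<lambda>x. m + k * (x - c))"
  unfolding increasing_bij_def
proof
  show "strict_mono (\<lambda>x. m + k * (x - c))"
    using assms by (auto intro!: strict_monoI)
  show "surj (\<lambda>x. m + k * (x - c))"
    using assms by (intro surjI[of _ "\<lambda>y. c + (y - m) / k"]) simp
qed

text \<open>With slope 1 on one side of \<open>m\<close>, this fixes that side pointwise and moves
  every point of the other.\<close>

lemma increasing_bij_kink:
  assumes "k > 0" "k' > 0"
  shows "increasing_bij (\<lambda>x. m + (if x < m then k else k') * (x - m))"
  unfolding increasing_bij_def
proof
  show "strict_mono (\<lambda>x. m + (if x < m then k else k') * (x - m))"
  proof (rule strict_monoI)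
    fix x y :: real assume "x < y"
    then consider "x < m" "y < m" | "x < m" "m \<le> y" | "m \<le> x" "m \<le> y"
      by linarith
    then show "m + (if x < m then k else k') * (x - m) < m + (if y < m then k else k') * (y - m)"
    proof cases
      case 2
      then have "k * (x - m) < 0" "k' * (y - m) \<ge> 0"
        using assms by (simp_all add: mult_pos_neg)
      with 2 show ?thesis
        by simp
    qed (use \<open>x < y\<close> assms in auto)
  qed
  show "surj (\<lambda>x. m + (if x < m then k else k') * (x - m))"
    using assms
    by (intro surjI[of _ "\<lambda>y. m + (y - m) / (if y < m then k else k')"])
      (auto simp: field_simps)
qed

lemma increasing_bij_comp:
  "increasing_bij \<phi> \<Longrightarrow> increasing_bij \<psi> \<Longrightarrow> increasing_bij (\<phi> \<circ> \<psi>)"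
  by (simp add: increasing_bij_def strict_mono_def comp_surj[unfolded comp_def])

lemma increasing_bij_two_points:
  fixes l h l' h' :: real
  assumes "l < h" "l' < h'"
  obtains \<phi> where "increasing_bij \<phi>" "\<phi> l = l'" "\<phi> h = h'"
proof
  show "increasing_bij (\<lambda>x. l' + (h' - l') / (h - l) * (x - l))"
    using assms by (intro increasing_bij_affine) simp
qed (use assms in auto)

text \<open>Shows that \<open>l\<close> and \<open>h\<close> are the only points of the line singled
  out by the pair \<open>(l, h)\<close> up to increasing bijections.\<close>

lemma increasing_bij_moving:
  fixes l h s :: real
  assumes "l < h" "s \<noteq> l" "s \<noteq> h"
  obtains \<phi> where "increasing_bij \<phi>" "\<phi> l = l" "\<phi> h = h" "\<phi> s \<noteq> s"
proof -
  consider "s < l" | "h < s" | "l < s" "s < h"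
    using assms by linarith
  then show thesis
  proof cases
    case 1
    show thesis
      by (rule that[OF increasing_bij_kink[of 2 1 l]]) (use 1 assms in auto)
  next
    case 2
    show thesis
      by (rule that[OF increasing_bij_kink[of 1 2 h]]) (use 2 assms in auto)
  next
    case 3
    \<comment> \<open>Stretch \<open>[s, h]\<close>, then rescale \<open>[l, 2 h - s]\<close> back to \<open>[l, h]\<close>.\<close>
    define k where "k = (h - l) / (2 * h - s - l)"
    have "0 < k" "k < 1" "k * (2 * h - s - l) = h - l"
      using 3 by (auto simp: k_def field_simps)
    define \<phi> where "\<phi> = (\<lambda>x. l + k * (x - l)) \<circ> (\<lambda>x. s + (if x < s then 1 else 2) * (x - s))"
    show thesis
    proof
      show "increasing_bij \<phi>"
        unfolding \<phi>_def using \<open>0 < k\<close>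
        by (intro increasing_bij_comp increasing_bij_affine increasing_bij_kink) simp_all
      show "\<phi> l = l"
        using 3 by (simp add: \<phi>_def)
      show "\<phi> h = h"
        using 3 \<open>k * (2 * h - s - l) = h - l\<close> by (simp add: \<phi>_def algebra_simps)
      have "k * (s - l) < 1 * (s - l)"
        using 3 \<open>k < 1\<close> by (intro mult_strict_right_mono) simp_all
      then show "\<phi> s \<noteq> s"
        by (simp add: \<phi>_def)
    qed
  qed
qed

section \<open>Classification of the definable relations\<close>

context unit_observer
begin

lemma lift_order_automorphism:
  assumes "natural_order X lt" "increasing_bij \<phi>"
  shows "lift \<phi> \<in> XL_order_automorphisms X lt"
proof -
  have "bij \<phi>" "strict_mono \<phi>"
    using assms(2) by (simp_all add: increasing_bij_imp_bij increasing_bij_def)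
  then show ?thesis
    using order_automorphism_iff[OF assms(1), of "lift \<phi>" \<phi>, OF lift_pt] lift_automorphism by blast
qed

text \<open>\<open>lift \<phi>\<close> brings \<open>y\<close> to an event with the required radar
  times but perhaps another spatial position; a swap with \<open>y'\<close> repairs this without
  moving \<open>X\<close>.\<close>

lemma definable_relation_move:
  assumes nat: "natural_order X lt"
    and R: "implicitly_definable (XL_order_automorphisms X lt) R"
    and sy: "(pt s, y) \<in> R" and "y \<notin> X" and \<phi>: "increasing_bij \<phi>"
    and y': "lo y' = \<phi> (lo y)" "hi y' = \<phi> (hi y)"
  shows "(pt (\<phi> s), y') \<in> R"
proof -
  define z where "z = lift \<phi> y"
  have less: "\<phi> (lo y) < \<phi> (hi y)"
    using \<phi> lo_less_hi[OF \<open>y \<notin> X\<close>] by (simp add: increasing_bij_def strict_mono_less)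
  have "(lift \<phi> (pt s), lift \<phi> y) \<in> R"
    using R lift_order_automorphism[OF nat \<phi>] sy by (rule implicitly_definableD)
  then have "(pt (\<phi> s), z) \<in> R"
    by (simp add: z_def)
  have lo_hi: "lo y' = lo z" "hi y' = hi z"
    using less y' by (simp_all add: z_def lo_lift hi_lift)
  have "z \<notin> X" "y' \<notin> X"
    using less lo_eq_hi_iff[of z] lo_eq_hi_iff[of y'] lo_hi y' by auto
  have pt_fixed: "Transposition.transpose z y' (pt r) = pt (id r)" for r
    using \<open>z \<notin> X\<close> \<open>y' \<notin> X\<close> pt_in_X[of r] by (auto simp: Transposition.transpose_def)
  have "Transposition.transpose z y' \<in> XL_automorphisms X"
    using \<open>z \<notin> X\<close> lo_hi by (rule transpose_automorphism)
  then have "Transposition.transpose z y' \<in> XL_order_automorphisms X lt"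
    using order_automorphism_iff[OF nat, of _ id, OF pt_fixed] by (simp add: strict_mono_def)
  then have "(Transposition.transpose z y' (pt (\<phi> s)), Transposition.transpose z y' z) \<in> R"
    using R \<open>(pt (\<phi> s), z) \<in> R\<close> by (blast intro: implicitly_definableD)
  then show ?thesis
    by (simp add: pt_fixed)
qed

text \<open>Increasing bijections act transitively on pairs \<open>l < h\<close>, so one linked pair
  on \<open>X\<close> puts all of \<open>X\<close> into one class. The link from \<open>X\<close> to
  \<open>y\<close> is then carried to every event off \<open>X\<close>.\<close>

lemma definable_relation_universal:
  assumes nat: "natural_order X lt"
    and R: "implicitly_definable (XL_order_automorphisms X lt) R" and eq: "equiv UNIV R"
    and sy: "(pt s, y) \<in> R" "y \<notin> X"
    and ss: "(pt s1, pt s2) \<in> R" "s1 \<noteq> s2"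
  shows "R = UNIV"
proof -
  have sym: "(q, p) \<in> R" if "(p, q) \<in> R" for p q
    using eq that by (meson equiv_def symD)
  have trans: "(p, r) \<in> R" if "(p, q) \<in> R" "(q, r) \<in> R" for p q r
    using eq that by (meson equiv_def transD)
  have refl: "(p, p) \<in> R" for p
    using eq by (meson UNIV_I equiv_def refl_onD)
  obtain l h where lh: "(pt l, pt h) \<in> R" "l < h"
    using ss sym[of "pt s1" "pt s2"] by (cases s1 s2 rule: linorder_cases) auto
  have less: "(pt r, pt r') \<in> R" if rr: "r < r'" for r r'
  proof -
    obtain \<phi> where "increasing_bij \<phi>" and \<phi>: "\<phi> l = r" "\<phi> h = r'"
      using increasing_bij_two_points[OF lh(2) rr] by metis
    then have "(lift \<phi> (pt l), lift \<phi> (pt h)) \<in> R"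
      using R lh(1) lift_order_automorphism[OF nat] by (blast intro: implicitly_definableD)
    then show ?thesis
      by (simp add: \<phi>)
  qed
  have pts: "(pt r, pt r') \<in> R" for r r'
    using less refl sym by (cases r r' rule: linorder_cases) auto
  have "(pt 0, p) \<in> R" for p
  proof (cases "p \<in> X")
    case True
    then show ?thesis
      using pts by (auto simp: X_eq)
  next
    case False
    obtain \<phi> where "increasing_bij \<phi>" "\<phi> (lo y) = lo p" "\<phi> (hi y) = hi p"
      using increasing_bij_two_points[OF lo_less_hi[OF sy(2)] lo_less_hi[OF False]] by metis
    then have "(pt (\<phi> s), p) \<in> R"
      using definable_relation_move[OF nat R sy] by simp
    then show ?thesis
      using pts trans by blast
  qed
  then show ?thesis
    using sym trans by (metis UNIV_eq_I surj_pair)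
qed

lemma definable_relation_cases:
  assumes nat: "natural_order X lt"
    and R: "implicitly_definable (XL_order_automorphisms X lt) R" and eq: "equiv UNIV R"
    and M: "satisfies_M X R"
  shows "R = {(p, q). lo p = lo q} \<or> R = {(p, q). hi p = hi q}"
proof -
  have sym: "(q, p) \<in> R" if "(p, q) \<in> R" for p q
    using eq that by (meson equiv_def symD)
  have trans: "(p, r) \<in> R" if "(p, q) \<in> R" "(q, r) \<in> R" for p q r
    using eq that by (meson equiv_def transD)
  have refl: "(p, p) \<in> R" for p
    using eq by (meson UNIV_I equiv_def refl_onD)
  obtain s y where sy: "(pt s, y) \<in> R" "y \<notin> X" and "R \<noteq> UNIV"
    using M by (auto simp: satisfies_M_def X_eq)
  then have discrete: "s1 = s2" if "(pt s1, pt s2) \<in> R" for s1 s2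
    using definable_relation_universal[OF nat R eq sy that] by blast
  have less: "lo y < hi y"
    using sy(2) by (rule lo_less_hi)
  \<comment> \<open>Such a \<open>c\<close> selects the point of \<open>X\<close> in the class of
    \<open>p\<close>, unique by \<open>discrete\<close>; so two events are related iff their
    selected points coincide.\<close>
  have kernel: "R = {(p, q). c p = c q}" if c: "\<And>p. (pt (c p), p) \<in> R" for c
  proof (intro set_eqI iffI)
    fix z assume "z \<in> R"
    moreover obtain p q where "z = (p, q)"
      by (cases z)
    ultimately show "z \<in> {(p, q). c p = c q}"
      using discrete[of "c p" "c q"] c sym trans by blast
  next
    fix z assume "z \<in> {(p, q). c p = c q}"
    then obtain p q where "z = (p, q)" "c p = c q"
      by auto
    then show "z \<in> R"
      using trans[OF sym[OF c[of p]], of q] c[of q] by simp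
  qed
  have moved: "\<exists>\<phi>. (pt (\<phi> s), p) \<in> R \<and> \<phi> (lo y) = lo p \<and> \<phi> (hi y) = hi p" if p: "p \<notin> X" for p
  proof -
    obtain \<phi> where "increasing_bij \<phi>" "\<phi> (lo y) = lo p" "\<phi> (hi y) = hi p"
      using increasing_bij_two_points[OF less lo_less_hi[OF p]] by metis
    then show ?thesis
      using definable_relation_move[OF nat R sy, of \<phi> p] by auto
  qed
  have "s = lo y \<or> s = hi y"
  proof (rule ccontr)
    assume "\<not> (s = lo y \<or> s = hi y)"
    then obtain \<phi> where "increasing_bij \<phi>" "\<phi> (lo y) = lo y" "\<phi> (hi y) = hi y" "\<phi> s \<noteq> s"
      using increasing_bij_moving[OF less] by metis
    then have "(pt (\<phi> s), y) \<in> R"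
      using definable_relation_move[OF nat R sy, of \<phi> y] by simp
    then show False
      using discrete[of "\<phi> s" s] sy(1) sym trans \<open>\<phi> s \<noteq> s\<close> by blast
  qed
  then show ?thesis
  proof
    assume "s = lo y"
    then have "(pt (lo p), p) \<in> R" for p
      using moved[of p] refl[of p] in_X_pt_lo[of p] by (cases "p \<in> X") auto
    then show ?thesis
      using kernel by blast
  next
    assume "s = hi y"
    then have "(pt (hi p), p) \<in> R" for p
      using moved[of p] refl[of p] by (cases "p \<in> X") (auto simp: X_eq)
    then show ?thesis
      using kernel by blast
  qed
qed

text \<open>Invariance under all automorphisms includes the order-preserving ones, so only two
  candidates remain. Time reversal maps a link from \<open>y\<close> to its emission event to a link
  with its reception event and vice versa, which neither kernel allows.\<close>

lemma no_XL_definable_relation: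
  assumes nat: "natural_order X lt"
    and R: "implicitly_definable (XL_automorphisms X) R" and eq: "equiv UNIV R"
  shows "\<not> satisfies_M X R"
proof
  assume "satisfies_M X R"
  moreover have "implicitly_definable (XL_order_automorphisms X lt) R"
    using R by (auto simp: implicitly_definable_def XL_order_automorphisms_def)
  ultimately have R_cases: "R = {(p, q). lo p = lo q} \<or> R = {(p, q). hi p = hi q}"
    using definable_relation_cases[OF nat] eq by blast
  obtain y where "y \<notin> X"
    using X_neq_UNIV by blast
  then have less: "lo y < hi y"
    by (rule lo_less_hi)
  have "lift uminus \<in> XL_automorphisms X"
    by (rule lift_automorphism) (simp add: bij_uminus)
  then have inv: "(lift uminus p, lift uminus q) \<in> R" if "(p, q) \<in> R" for p q
    using R that by (blast intro: implicitly_definableD)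
  show False
    using R_cases inv[of "pt (lo y)" y] inv[of "pt (hi y)" y] less
    by (auto simp: lo_lift hi_lift)
qed

section \<open>Explicit definitions\<close>

text \<open>Variable 2 is a \<open>below\<close>-minimal vertex among the cones through event
  \<open>i\<close>. Keeping \<open>below\<close> abstract lets one formula serve for the earliest
  and the latest vertex.\<close>

definition extremal_cone_fm :: "(nat \<Rightarrow> nat \<Rightarrow> order_atom) \<Rightarrow> nat \<Rightarrow> order_atom fm" where
  "extremal_cone_fm below i =
     Conj (OnCone 2 i) (Neg (Exists 3 (Conj (OnCone 3 i) (Atom (below 3 2)))))"

definition extremal_fm :: "(nat \<Rightarrow> nat \<Rightarrow> order_atom) \<Rightarrow> order_atom fm" where
  "extremal_fm below = Exists 2 (Conj (extremal_cone_fm below 0) (extremal_cone_fm below 1))"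

lemma sat_extremal_fm:
  assumes below: "\<And>e i j. order_atom_sat lt e (below i j) \<longleftrightarrow> (e i, e j) \<in> r"
    and extremal: "\<And>p s. p \<in> light_cone (pt s) \<and>
      (\<forall>s'. p \<in> light_cone (pt s') \<longrightarrow> (pt s', pt s) \<notin> r) \<longleftrightarrow> s = c p"
  shows "sat X (order_atom_sat lt) e (extremal_fm below) \<longleftrightarrow> c (e 0) = c (e 1)"
proof -
  have "sat X (order_atom_sat lt) (e(2 := x)) (extremal_cone_fm below i) \<longleftrightarrow> x = pt (c (e i))"
    \<comment> \<open>Variables 2 and 3 are reserved for the vertices, so this avoids
      capture.\<close>
    if "i \<noteq> 2" "i \<noteq> 3" for i x
  proof (cases "x \<in> X")
    case True
    then obtain s where "x = pt s"
      by (auto simp: X_eq)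
    have "sat X (order_atom_sat lt) (e(2 := pt s)) (extremal_cone_fm below i) \<longleftrightarrow>
        e i \<in> light_cone (pt s) \<and> (\<forall>s'. e i \<in> light_cone (pt s') \<longrightarrow> (pt s', pt s) \<notin> r)"
      using that by (auto simp: extremal_cone_fm_def below X_eq)
    also have "\<dots> \<longleftrightarrow> s = c (e i)"
      by (rule extremal)
    finally show ?thesis
      by (simp add: \<open>x = pt s\<close>)
  qed (auto simp: extremal_cone_fm_def)
  then show ?thesis
    by (simp add: extremal_fm_def)
qed

lemma kernels_explicitly_definable:
  assumes nat: "natural_order X lt"
  shows "explicitly_XL_order_definable X lt {(p, q). lo p = lo q}"
    and "explicitly_XL_order_definable X lt {(p, q). hi p = hi q}"
proof -
  have definable: "explicitly_XL_order_definable X lt {(p, q). c p = c q}"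
    if "\<And>e. sat X (order_atom_sat lt) e (extremal_fm below) \<longleftrightarrow> c (e 0) = c (e 1)"
      and "\<And>i j. order_atom_vars (below i j) = {i, j}" for c :: "event \<Rightarrow> real" and below
    unfolding explicitly_XL_order_definable_def explicitly_definable_def
    using that by (intro exI[of _ "extremal_fm below"]) (auto simp: extremal_fm_def extremal_cone_fm_def)
  have first: "p \<in> light_cone (pt s) \<and>
      (\<forall>s'. p \<in> light_cone (pt s') \<longrightarrow> \<not> s' < s) \<longleftrightarrow> s = lo p" for p s
    using lo_le_hi[of p] by (auto simp: in_light_cone_iff)
  have last: "p \<in> light_cone (pt s) \<and>
      (\<forall>s'. p \<in> light_cone (pt s') \<longrightarrow> \<not> s < s') \<longleftrightarrow> s = hi p" for p s
    using lo_le_hi[of p] by (auto simp: in_light_cone_iff)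
  have fwd: "order_atom_sat lt e (Less i j) \<longleftrightarrow> (e i, e j) \<in> lt" for e i j
    by simp
  \<comment> \<open>Swapping the arguments of the atom expresses the converse order, which turns
    minimal vertices into maximal ones.\<close>
  have bwd: "order_atom_sat lt e (Less j i) \<longleftrightarrow> (e i, e j) \<in> lt\<inverse>" for e i j
    by simp
  note sat_fwd = sat_extremal_fm[where below = Less, OF fwd]
    and sat_bwd = sat_extremal_fm[where below = "\<lambda>i j. Less j i", OF bwd]
  from natural_order_cases[OF nat]
  have "explicitly_XL_order_definable X lt {(p, q). lo p = lo q} \<and>
    explicitly_XL_order_definable X lt {(p, q). hi p = hi q}"
  proof
    assume lt: "\<forall>s s'. (pt s, pt s') \<in> lt \<longleftrightarrow> s < s'"
    show ?thesis
      using definable[OF sat_fwd[of lo]] definable[OF sat_bwd[of hi]] lt first last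
      by (simp add: insert_commute)
  next
    assume lt: "\<forall>s s'. (pt s, pt s') \<in> lt \<longleftrightarrow> s' < s"
    show ?thesis
      using definable[OF sat_bwd[of lo]] definable[OF sat_fwd[of hi]] lt first last
      by (simp add: insert_commute)
  qed
  then show "explicitly_XL_order_definable X lt {(p, q). lo p = lo q}"
    and "explicitly_XL_order_definable X lt {(p, q). hi p = hi q}"
    by blast+
qed

end

section \<open>Normalising the observer\<close>

text \<open>Two timelike vectors are never orthogonal, so the direction can be scaled to length 1
  with the sign that puts it in \<open>Or\<close>; the line is unchanged.\<close>

lemma unit_observer_exists:
  assumes Or: "time_orientation Or" and X: "inertial_observer X"
  obtains a v where "unit_observer a v X" "v \<in> Or"
proof -
  obtain u where u: "eta u u > 0" and Or_eq: "Or = {w. eta w w > 0 \<and> eta u w > 0}"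
    using Or by (auto simp: time_orientation_def)
  obtain a w where w: "eta w w > 0" and X_eq: "X = range (\<lambda>s. a + s *\<^sub>R w)"
    using X by (auto simp: inertial_observer_def)
  have "w \<noteq> 0"
    using w by (auto simp: eta_zero_left)
  then have "eta u w \<noteq> 0"
    using timelike_orthogonal[of u w] u w by (auto simp: eta_commute)
  define k where "k = sgn (eta u w) / sqrt (eta w w)"
  have "k \<noteq> 0"
    using \<open>eta u w \<noteq> 0\<close> w by (simp add: k_def sgn_zero_iff)
  have norm: "eta (k *\<^sub>R w) (k *\<^sub>R w) = 1"
    using \<open>eta u w \<noteq> 0\<close> w by (simp add: eta_bilinear k_def sgn_if)
  have pos: "eta u (k *\<^sub>R w) > 0"
    using \<open>eta u w \<noteq> 0\<close> w by (simp add: eta_bilinear k_def sgn_if)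
  have "X = range (\<lambda>s. a + s *\<^sub>R (k *\<^sub>R w))"
  proof -
    have "range (\<lambda>s. a + s *\<^sub>R w) = (\<lambda>s. a + s *\<^sub>R w) ` range (\<lambda>s. s * k)"
      using \<open>k \<noteq> 0\<close> by (subst surjI[of "\<lambda>s. s * k" "\<lambda>s. s / k"]) simp_all
    then show ?thesis
      by (simp add: X_eq image_image)
  qed
  then have "unit_observer a (k *\<^sub>R w) X"
    using norm by unfold_locales
  moreover have "k *\<^sub>R w \<in> Or"
    using norm pos by (simp add: Or_eq)
  ultimately show thesis
    by (rule that)
qed

section \<open>Radar coordinates and the relations Gamma\<close>

definition RTwo :: rtm where "RTwo = RAdd ROne ROne"

text \<open>The last conjunct excludes \<open>j = k\<close> when \<open>i\<close> is off \<open>X\<close>, so \<open>j\<close> and \<open>k\<close> are the emission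
  and the reception event of \<open>i\<close>.\<close>

definition radar_fm :: "nat \<Rightarrow> nat \<Rightarrow> nat \<Rightarrow> clock_atom fm" where
  "radar_fm i j k = Conj (OnCone j i) (Conj (OnCone k i)
     (Conj (Neg (Atom (RLess (TDiff k j) RZero))) (Neg (Conj (EqF j k) (Neg (InX i))))))"

text \<open>With emission times \<open>T\<^sub>2, T\<^sub>4\<close> and reception times \<open>T\<^sub>3, T\<^sub>5\<close> of the two events, this is
  \<open>(T\<^sub>2 + T\<^sub>3) / 2 - (T\<^sub>4 + T\<^sub>5) / 2 = f ((T\<^sub>3 - T\<^sub>2) / 2) - f ((T\<^sub>5 - T\<^sub>4) / 2)\<close>.\<close>

definition Gamma_atom :: clock_atom where
  "Gamma_atom = REq (RDiv (RAdd (TDiff 2 4) (TDiff 3 5)) RTwo)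
     (RSub (App (RDiv (TDiff 3 2) RTwo)) (App (RDiv (TDiff 5 4) RTwo)))"

definition Gamma_fm :: "clock_atom fm" where
  "Gamma_fm = Exists 2 (Exists 3 (Exists 4 (Exists 5
     (Conj (radar_fm 0 2 3) (Conj (radar_fm 1 4 5) (Atom Gamma_atom))))))"

text \<open>Radar times give \<open>t\<close> as half-sum and \<open>r\<close> as half-difference. A
  clock known up to a constant still determines differences of \<open>t\<close>, and these suffice
  once \<tau> is eliminated.\<close>

lemma Gamma_rel_explicitly_definable:
  assumes Tt: "clock_mod_const X Tt" and c: "adapted_coordinates X Tt c"
  shows "explicitly_XL_clock_definable X Tt f (Gamma_rel c f)"
proof -
  define t r where "t p = fst (c p)" and "r p = norm (snd (c p))" for p
  have X: "x \<in> X \<longleftrightarrow> r x = 0" for x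
    using c by (auto simp: adapted_coordinates_def r_def)
  have bij: "bij c"
    and form: "eta (p - q) (p - q) = (t p - t q)\<^sup>2 - (norm (snd (c p) - snd (c q)))\<^sup>2" for p q
    using c by (auto simp: adapted_coordinates_def inertial_coordinates_def t_def)
  have r_nonneg: "r p \<ge> 0" for p
    by (simp add: r_def)
  have cone: "p \<in> light_cone x \<longleftrightarrow> t x = t p - r p \<or> t x = t p + r p" if "x \<in> X" for x p
  proof -
    have "snd (c x) = 0"
      using that X by (simp add: r_def)
    then have "p \<in> light_cone x \<longleftrightarrow> (t p - t x)\<^sup>2 = (r p)\<^sup>2"
      by (simp add: light_cone_def form r_def)
    then show ?thesis
      by (auto simp: power2_eq_iff)
  qed
  have t_inj: "x = x'" if "x \<in> X" "x' \<in> X" "t x = t x'" for x x'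
  proof -
    have "c x = c x'"
      using that X by (simp add: prod_eq_iff t_def r_def)
    then show ?thesis
      using bij by (simp add: bij_is_inj inj_eq)
  qed
  have t_surj: "\<exists>x\<in>X. t x = s" for s
  proof -
    obtain x where "c x = (s, 0)"
      using bij by (metis bij_pointE)
    then show ?thesis
      using X by (intro bexI[of _ x]) (simp_all add: t_def r_def)
  qed
  have diff: "clock_diff Tt x x' = t x - t x'" if "x \<in> X" "x' \<in> X" for x x'
  proof -
    obtain T where T: "Tt = clock_class X T"
      using Tt by (auto simp: clock_mod_const_def)
    have "t \<in> clock_class X T"
      unfolding T[symmetric] t_def[abs_def] using c by (simp add: adapted_coordinates_def)
    then obtain d where "\<forall>x\<in>X. t x = T x + d"
      by (auto simp: clock_class_def)
    then show ?thesis
      using that clock_diff_class[OF that, of T] T by simp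
  qed
  have radar: "sat X (clock_atom_sat X Tt f) e (radar_fm i j k) \<longleftrightarrow>
      e j \<in> X \<and> e k \<in> X \<and> t (e j) = t (e i) - r (e i) \<and> t (e k) = t (e i) + r (e i)" for e i j k
  proof (cases "e j \<in> X \<and> e k \<in> X")
    case True
    then show ?thesis
      using r_nonneg[of "e i"] X[of "e i"] t_inj[of "e j" "e k"]
      by (auto simp: radar_fm_def cone diff)
  qed (auto simp: radar_fm_def)
  have rel: "(p, q) \<in> Gamma_rel c f \<longleftrightarrow> t p - t q = f (r p) - f (r q)" for p q
  proof -
    have "(p, q) \<in> Gamma_rel c f \<longleftrightarrow> (\<exists>\<tau>. t p = f (r p) + \<tau> \<and> t q = f (r q) + \<tau>)"
      by (simp add: Gamma_rel_def Gamma_set_def t_def r_def)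
    also have "\<dots> \<longleftrightarrow> t p - t q = f (r p) - f (r q)"
      by (auto intro!: exI[of _ "t p - f (r p)"])
    finally show ?thesis .
  qed
  have "sat X (clock_atom_sat X Tt f) e Gamma_fm \<longleftrightarrow> (e 0, e 1) \<in> Gamma_rel c f" for e
  proof -
    obtain x2 x3 x4 x5 where x: "x2 \<in> X" "x3 \<in> X" "x4 \<in> X" "x5 \<in> X"
      "t x2 = t (e 0) - r (e 0)" "t x3 = t (e 0) + r (e 0)"
      "t x4 = t (e 1) - r (e 1)" "t x5 = t (e 1) + r (e 1)"
      using t_surj by metis
    have body: "sat X (clock_atom_sat X Tt f) (e(2 := y2, 3 := y3, 4 := y4, 5 := y5))
        (Conj (radar_fm 0 2 3) (Conj (radar_fm 1 4 5) (Atom Gamma_atom)))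
      \<longleftrightarrow> (y2 \<in> X \<and> y3 \<in> X \<and> t y2 = t (e 0) - r (e 0) \<and> t y3 = t (e 0) + r (e 0)) \<and>
        (y4 \<in> X \<and> y5 \<in> X \<and> t y4 = t (e 1) - r (e 1) \<and> t y5 = t (e 1) + r (e 1)) \<and>
        t (e 0) - t (e 1) = f (r (e 0)) - f (r (e 1))" (is "_ \<longleftrightarrow> ?A \<and> ?B \<and> ?C") for y2 y3 y4 y5
    proof (cases "?A \<and> ?B")
      case True
      let ?e = "e(2 := y2, 3 := y3, 4 := y4, 5 := y5)"
      \<comment> \<open>All clock differences are taken on \<open>X\<close> and the arguments of
        \<open>App\<close> are nonnegative radii, so no default value of \<open>rtm_val\<close>
        enters.\<close>
      have "rtm_val X Tt f ?e (RDiv (RAdd (TDiff 2 4) (TDiff 3 5)) RTwo) = t (e 0) - t (e 1)"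
        "rtm_val X Tt f ?e (RDiv (TDiff 3 2) RTwo) = r (e 0)"
        "rtm_val X Tt f ?e (RDiv (TDiff 5 4) RTwo) = r (e 1)"
        using True by (simp_all add: diff RTwo_def)
      then have "clock_atom_sat X Tt f ?e Gamma_atom \<longleftrightarrow> ?C"
        using r_nonneg[of "e 0"] r_nonneg[of "e 1"] unfolding Gamma_atom_def
        by (simp only: clock_atom_sat.simps rtm_val.simps(5,8) if_True)
      then show ?thesis
        using True by (simp add: radar)
    qed (auto simp: radar)
    show ?thesis
      unfolding rel Gamma_fm_def sat.simps(7) body using x by blast
  qed
  moreover have "fv clock_atom_vars Gamma_fm \<subseteq> {0, 1}"
    by (auto simp: Gamma_fm_def Gamma_atom_def radar_fm_def RTwo_def)
  ultimately show ?thesis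
    unfolding explicitly_XL_clock_definable_def explicitly_definable_def by blast
qed

theorem theorem5p1:
  fixes Or X :: "event set" and lt :: "event rel" and Tt :: "(event \<Rightarrow> real) set"
  assumes "time_orientation Or"
    and "inertial_observer X"
    and "natural_order X lt"
    and "clock_mod_const X Tt"
    and "increasing_to_future Or X Tt"
  shows
    "(\<nexists>R. equiv UNIV R \<and> implicitly_definable (XL_automorphisms X) R \<and> satisfies_M X R) \<and>
     (\<forall>R. equiv UNIV R \<and> implicitly_definable (XL_order_automorphisms X lt) R \<and> satisfies_M X R
        \<longleftrightarrow> R = Lambda_plus Or X \<or> R = Lambda_minus Or X) \<and>
     explicitly_XL_order_definable X lt (Lambda_plus Or X) \<and>
     explicitly_XL_order_definable X lt (Lambda_minus Or X) \<and>
     (\<forall>c. adapted_coordinates X Tt c \<longrightarrow>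
        (\<forall>f :: real \<Rightarrow> real. f 0 = 0 \<longrightarrow> explicitly_XL_clock_definable X Tt f (Gamma_rel c f)))"
proof -
  obtain a v where "unit_observer a v X" and "v \<in> Or"
    using unit_observer_exists assms(1,2) by blast
  then interpret unit_observer a v X
    by blast
  note nat = \<open>natural_order X lt\<close>
  \<comment> \<open>Since \<open>v\<close> is future-directed, the kernel of \<open>lo\<close> is
    \<open>Lambda_plus\<close> and that of \<open>hi\<close> is \<open>Lambda_minus\<close>.\<close>
  note Lambda = Lambda_cone_eq[OF assms(1) \<open>v \<in> Or\<close>]
  have "equiv UNIV R \<and> implicitly_definable (XL_order_automorphisms X lt) R \<and> satisfies_M X R
      \<longleftrightarrow> R = Lambda_plus Or X \<or> R = Lambda_minus Or X" for R
    unfolding Lambda using definable_relation_cases[OF nat] kernels_satisfy[OF nat] by blast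
  moreover have "explicitly_XL_order_definable X lt (Lambda_plus Or X)"
    "explicitly_XL_order_definable X lt (Lambda_minus Or X)"
    unfolding Lambda by (fact kernels_explicitly_definable[OF nat])+
  ultimately show ?thesis
    using no_XL_definable_relation[OF nat] Gamma_rel_explicitly_definable[OF assms(4)] by blast
qed

end
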